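(* Let $p$ be a prime, $m$ a positive integer, and let $\mathcal H=[\,I_p\,|\,C\,]$ with $C=[\,C_1\,|\,\cdots\,|\,C_{m-1}\,]$ be a $p\times mp$ matrix over $\mathbb F_{2^l}$, where each $C_i$ is a circulant $p\times p$ matrix having at least one entry in $\mathbb F_{2^l}\setminus\mathbb F_2$, no two columns of $C$ are identical, and the permutation group $T_{\mathcal H}$ is not 2-transitive on $p$ letters. Then $|\mathrm{Aut}(\mathcal H)|\le p(p-1)$.
   Context: A $p\times p$ matrix is circulant if every row except the first is the cyclic right shift of the row above it. $S_n$ is identified with the group of $n\times n$ permutation matrices. $T_{\mathcal H}=\{P_1\in S_p:\ \exists P_2\in S_{(m-1)p},\ P_1CP_2=C\}$. $\mathrm{Aut}(\mathcal H)=\{P\in S_{mp}:\ \exists A\in \mathrm{GL}_p(\mathbb F_2),\ A\mathcal HP=\mathcal H\}$. *)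

theory Defs
  imports
    "Jordan_Normal_Form.Matrix"
    "HOL-Computational_Algebra.Primes"
    "HOL-Combinatorics.Permutations"
    "HOL-Library.Cardinality"
begin

(* Indices run from 0, so the letters permuted by S_n are 0, ..., n - 1. *)
definition circulant :: "nat \<Rightarrow> 'a mat \<Rightarrow> bool" where
  "circulant n M \<longleftrightarrow> M \<in> carrier_mat n n \<and>
     (\<forall>i j. Suc i < n \<longrightarrow> j < n \<longrightarrow> M $$ (Suc i, Suc j mod n) = M $$ (i, j))"

(* [ M1 | M2 | ... ]; n is the number of rows, needed when the list is empty. *)
definition hcat :: "nat \<Rightarrow> 'a mat list \<Rightarrow> 'a mat" where
  "hcat n Ms = mat_of_cols n (concat (map cols Ms))"

(* The prime subfield of a field of characteristic 2, as a subset of that field. *)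
definition F2 :: "'a :: field set" where
  "F2 = {0, 1}"

(* Both the matrix and its inverse have entries in the subfield K. *)
definition GL :: "nat \<Rightarrow> 'a :: field set \<Rightarrow> 'a mat set" where
  "GL n K = {A \<in> carrier_mat n n. elements_mat A \<subseteq> K \<and>
     (\<exists>B \<in> carrier_mat n n. elements_mat B \<subseteq> K \<and> inverts_mat A B \<and> inverts_mat B A)}"

(* The matrix sending the j-th unit vector to the (s j)-th one.  For s permuting {..<n} this is
   the identification of S_n with the n x n permutation matrices, and
   perm_mat n (s o t) = perm_mat n s * perm_mat n t. *)
definition perm_mat :: "nat \<Rightarrow> (nat \<Rightarrow> nat) \<Rightarrow> 'a :: zero_neq_one mat" where
  "perm_mat n s = mat n n (\<lambda>(i, j). if i = s j then 1 else 0)"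

(* T_H and Aut(H) as sets of permutations, via the identification perm_mat.
   T_H depends on H = [ I | C ] only through C. *)
definition T_group :: "'a :: field mat \<Rightarrow> (nat \<Rightarrow> nat) set" where
  "T_group C = {s. s permutes {..<dim_row C} \<and>
     (\<exists>t. t permutes {..<dim_col C} \<and>
        perm_mat (dim_row C) s * C * perm_mat (dim_col C) t = C)}"

definition Aut :: "'a :: field mat \<Rightarrow> (nat \<Rightarrow> nat) set" where
  "Aut H = {s. s permutes {..<dim_col H} \<and>
     (\<exists>A \<in> GL (dim_row H) F2. A * H * perm_mat (dim_col H) s = H)}"

definition two_transitive_on :: "(nat \<Rightarrow> nat) set \<Rightarrow> nat set \<Rightarrow> bool" where
  "two_transitive_on G X \<longleftrightarrow>
     (\<forall>a\<in>X. \<forall>b\<in>X. \<forall>c\<in>X. \<forall>d\<in>X. a \<noteq> b \<longrightarrow> c \<noteq> d \<longrightarrow> (\<exists>g\<in>G. g a = c \<and> g b = d))"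

lemma perm_mat_mult:
  assumes "t permutes {..<n}"
  shows "perm_mat n (s \<circ> t) = (perm_mat n s * perm_mat n t :: 'a :: field mat)"
proof (rule eq_matI)
  fix i j assume "i < dim_row (perm_mat n s * perm_mat n t :: 'a mat)"
    "j < dim_col (perm_mat n s * perm_mat n t :: 'a mat)"
  then have ij: "i < n" "j < n" by (auto simp: perm_mat_def)
  have tj: "t j < n" using permutes_in_image[OF assms, of j] ij by simp
  have "(perm_mat n s * perm_mat n t :: 'a mat) $$ (i, j)
      = (\<Sum>k = 0..<n. (if i = s k then 1 else 0) * (if k = t j then 1 else 0))"
    using ij by (simp add: perm_mat_def scalar_prod_def)
  also have "\<dots> = (\<Sum>k = 0..<n. if k = t j then (if i = s k then 1 else 0) else 0)"
    by (rule sum.cong) auto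
  also have "\<dots> = (if i = s (t j) then 1 else 0)"
    using tj by simp
  finally show "(perm_mat n (s \<circ> t) :: 'a mat) $$ (i, j)
      = (perm_mat n s * perm_mat n t :: 'a mat) $$ (i, j)"
    using ij by (simp add: perm_mat_def)
qed (auto simp: perm_mat_def)

lemma inj_on_perm_mat:
  "inj_on (perm_mat n :: _ \<Rightarrow> 'a :: zero_neq_one mat) {s. s permutes {..<n}}"
proof (rule inj_onI)
  fix s t assume s: "s \<in> {s. s permutes {..<n}}" and t: "t \<in> {s. s permutes {..<n}}"
    and eq: "(perm_mat n s :: 'a mat) = perm_mat n t"
  show "s = t"
  proof
    fix j
    show "s j = t j"
    proof (cases "j < n")
      case True
      then have sj: "s j < n" using permutes_in_image[of s "{..<n}" j] s by simp
      have "(perm_mat n s :: 'a mat) $$ (s j, j) = perm_mat n t $$ (s j, j)" using eq by simp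
      then show ?thesis using True sj by (simp add: perm_mat_def split: if_splits)
    next
      case False
      then show ?thesis using s t by (simp add: permutes_def)
    qed
  qed
qed

lemma finite_Aut: "finite (Aut H)"
  by (rule finite_subset[OF _ finite_permutations[of "{..<dim_col H}"]]) (auto simp: Aut_def)

end

theory Submission
  imports Defs
    "HOL-Number_Theory.Residues"
    "HOL-Computational_Algebra.Polynomial"
begin

text \<open>Let \<open>A H P = H\<close>. Multiplication by \<open>A\<close> and its inverse preserves the vectors over the prime field,
  and every column of \<open>C\<close> has an entry outside it. Hence \<open>P\<close> permutes the columns of the identity block
  among themselves, \<open>A\<close> is a permutation matrix in \<open>T\<close>, and since the columns of \<open>C\<close> are distinct, \<open>A\<close>
  determines \<open>P\<close>. So \<open>|Aut H| \<le> |T|\<close>. As the blocks are circulant, \<open>T\<close> contains the standard \<open>p\<close>-cycle,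
  and Burnside's theorem on transitive groups of prime degree puts \<open>T\<close>, which is not 2-transitive,
  into the affine group of order \<open>p (p - 1)\<close>. Burnside's theorem is proved by P. Mueller's
  polynomial argument. Polynomials over the field with \<open>p\<close> elements are represented by integer
  polynomials modulo \<open>p\<close>, because \<open>p\<close> is a variable and no type depends on it.\<close>

section \<open>Polynomial functions modulo a prime\<close>

text \<open>This is the bound on the number of roots over the field with \<open>p\<close> elements,
  by induction on \<open>k\<close>. Division by \<open>X - k\<close> leaves the remainder
  \<open>poly q k\<close>, which \<open>p\<close> divides. The quotient inherits the remaining
  roots, because \<open>x - k\<close> is prime to \<open>p\<close> for
  \<open>x < k < p\<close>.\<close>

lemma coeffs_dvd_if_values_dvd:
  fixes q :: "int poly"
  assumes p: "prime p" and "k \<le> p" "degree q < k" "\<And>x. x < k \<Longrightarrow> int p dvd poly q (int x)"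
  shows "int p dvd coeff q i"
  using assms(2-)
proof (induction k arbitrary: q i)
  case 0
  then show ?case by simp
next
  case (Suc k)
  define s where "s = synthetic_div q (int k)"
  have q: "q = [:- int k, 1:] * s + [:poly q (int k):]"
    unfolding s_def by (rule synthetic_div_correct'[symmetric])
  have qk: "int p dvd poly q (int k)"
    using Suc.prems by simp
  have s: "int p dvd coeff s j" for j
  \<comment> \<open>For \<open>k = 0\<close> the induction hypothesis would demand
    \<open>degree s < 0\<close>. In that case \<open>q\<close> is constant and the quotient is
    zero.\<close>
  proof (cases "k = 0")
    case True
    then have "s = 0"
      using Suc.prems(2) by (simp add: s_def synthetic_div_eq_0_iff)
    then show ?thesis by simp
  next
    case False
    show ?thesis
    proof (rule Suc.IH)
      show "degree s < k"
        using Suc.prems(2) False unfolding s_def by (simp add: degree_synthetic_div)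
      show "int p dvd poly s (int x)" if x: "x < k" for x
      proof -
        have "poly q (int x) = (int x - int k) * poly s (int x) + poly q (int k)"
          by (subst q) (simp add: algebra_simps)
        then have "int p dvd (int x - int k) * poly s (int x)"
          using Suc.prems(3)[of x] x dvd_add_left_iff[OF qk] by simp
        moreover have "\<not> int p dvd int x - int k"
        proof
          assume "int p dvd int x - int k"
          then have "int p dvd int (k - x)"
            using x by (simp add: of_nat_diff dvd_diff_commute)
          then have "p \<le> k - x"
            using x dvd_imp_le[of p "k - x"] by (simp only: int_dvd_int_iff)
          then show False using Suc.prems(1) x by simp
        qed
        ultimately show ?thesis
          using p by (meson prime_dvd_mult_iff prime_nat_int_transfer)
      qed
    qed (use Suc.prems in simp)
  qed
  have "coeff q i = - int k * coeff s i + coeff (pCons 0 s) i + coeff [:poly q (int k):] i"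
    by (subst q) simp
  moreover have "int p dvd coeff (pCons 0 s) i" "int p dvd coeff [:poly q (int k):] i"
    using s qk by (auto simp: coeff_pCons split: nat.splits)
  ultimately show ?case
    using s by simp
qed

text \<open>A function has at most one degree \<open>d < p\<close> in this sense, because a polynomial of degree
  less than \<open>p\<close> is determined modulo \<open>p\<close> by its values.\<close>

definition has_degree_mod :: "nat \<Rightarrow> (int \<Rightarrow> int) \<Rightarrow> nat \<Rightarrow> bool" where
  "has_degree_mod p f d \<longleftrightarrow> (\<exists>q. degree q = d \<and> \<not> int p dvd lead_coeff q \<and>
     (\<forall>x. [f x = poly q x] (mod int p)))"

lemma has_degree_mod_not_zero:
  assumes "prime p" "has_degree_mod p f d" "d < p"
  shows "\<exists>x. \<not> [f x = 0] (mod int p)"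
proof (rule ccontr)
  assume "\<not> ?thesis"
  then have f: "[f x = 0] (mod int p)" for x by blast
  obtain q where q: "degree q = d" "\<not> int p dvd lead_coeff q" "\<And>x. [f x = poly q x] (mod int p)"
    using assms(2) by (auto simp: has_degree_mod_def)
  have "int p dvd poly q x" for x
    using f[of x] q(3)[of x] by (metis cong_0_iff cong_sym cong_trans)
  then show False
    using coeffs_dvd_if_values_dvd[OF assms(1) order_refl] q assms(3) by blast
qed

lemma has_degree_mod_unique:
  assumes p: "prime p" and f: "has_degree_mod p f d" "has_degree_mod p f e" and "d < p" "e < p"
  shows "d = e"
proof -
  obtain q where q: "degree q = d" "\<not> int p dvd lead_coeff q" "\<And>x. [f x = poly q x] (mod int p)"
    using f(1) by (auto simp: has_degree_mod_def)
  obtain r where r: "degree r = e" "\<not> int p dvd lead_coeff r" "\<And>x. [f x = poly r x] (mod int p)"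
    using f(2) by (auto simp: has_degree_mod_def)
  have "int p dvd poly (q - r) x" for x
    using cong_trans[OF cong_sym[OF q(3)[of x]] r(3)[of x]] by (simp add: cong_iff_dvd_diff)
  moreover have "degree (q - r) < p"
    using q(1) r(1) assms(4,5) by (simp add: degree_diff_less)
  ultimately have *: "int p dvd coeff q i - coeff r i" for i
    using coeffs_dvd_if_values_dvd[OF p order_refl, of "q - r" i] by simp
  show ?thesis
  proof (cases rule: linorder_cases[of d e])
    case less
    then show ?thesis using *[of e] coeff_eq_0[of q e] q(1) r(1,2) by simp
  next
    case greater
    then show ?thesis using *[of d] coeff_eq_0[of r d] r(1) q(1,2) by simp
  qed simp
qed

text \<open>The leading coefficient stays prime to \<open>p\<close> because \<open>p\<close> is
  prime. No reduction by \<open>x ^ p = x\<close> takes place, so \<open>k * d\<close> may reach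
  \<open>p\<close>; uniqueness of degrees can be applied only when it does not.\<close>

lemma has_degree_mod_power:
  assumes "prime p" "has_degree_mod p f d"
  shows "has_degree_mod p (\<lambda>x. f x ^ k) (k * d)"
proof -
  obtain q where q: "degree q = d" "\<not> int p dvd lead_coeff q" "\<And>x. [f x = poly q x] (mod int p)"
    using assms(2) by (auto simp: has_degree_mod_def)
  have "\<not> int p dvd lead_coeff q ^ k"
    using q(2) assms(1) prime_dvd_power[of "int p"] by auto
  then have "\<not> int p dvd lead_coeff (q ^ k)"
    by (simp add: lead_coeff_power)
  moreover have "degree (q ^ k) = k * d"
    using q(1,2) by (cases "q = 0") (simp_all add: degree_power_eq)
  ultimately show ?thesis
    using q(3) by (auto simp: has_degree_mod_def intro!: exI[of _ "q ^ k"] cong_pow)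
qed

lemma has_degree_mod_const:
  assumes "\<not> int p dvd c" "\<And>x. [f x = c] (mod int p)"
  shows "has_degree_mod p f 0"
  unfolding has_degree_mod_def using assms by (intro exI[of _ "[:c:]"]) simp

lemma fermat_theorem_int:
  assumes p: "prime p" and a: "\<not> int p dvd a"
  shows "[a ^ (p - 1) = 1] (mod int p)"
proof -
  define c where "c = nat (a mod int p)"
  have c: "[a = int c] (mod int p)"
    using prime_gt_0_nat[OF p] by (simp add: c_def cong_def)
  then have "\<not> p dvd c"
    using a cong_dvd_iff[OF c] by simp
  then have "[int (c ^ (p - 1)) = int 1] (mod int p)"
    using fermat_theorem[OF p] by (simp only: cong_int_iff)
  then have "[int c ^ (p - 1) = 1] (mod int p)"
    by simp
  then show ?thesis
    using c by (meson cong_pow cong_trans)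
qed

text \<open>By Fermat's little theorem \<open>1 - (X - a) ^ (p - 1)\<close> is the indicator
  function of the residue class of \<open>a\<close>. The sum of these polynomials weighted by
  \<open>f a\<close> has degree at most \<open>p - 1\<close>.\<close>

lemma poly_interpolation_mod:
  assumes p: "prime p" and f: "\<And>x y. [x = y] (mod int p) \<Longrightarrow> [f x = f y] (mod int p)"
  obtains q :: "int poly" where "degree q < p" "\<And>x. [f x = poly q x] (mod int p)"
proof
  define g :: "nat \<Rightarrow> int poly" where "g = (\<lambda>a. smult (f (int a)) (1 - [:- int a, 1:] ^ (p - 1)))"
  have p1: "p > 1" using p by (rule prime_gt_1_nat)
  have dg: "degree (g a) \<le> p - 1" for a
    unfolding g_def
    by (intro order.trans[OF degree_smult_le] degree_diff_le) (auto simp: degree_linear_power)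
  then show "degree (\<Sum>a<p. g a) < p"
    using p1 degree_sum_le[of "{..<p}" g "p - 1"] by simp
  show "[f x = poly (\<Sum>a<p. g a) x] (mod int p)" for x
  proof -
    define b where "b = nat (x mod int p)"
    have b: "b < p" "int b = x mod int p"
      using p1 by (auto simp: b_def nat_less_iff)
    have "[poly (g a) x = (if a = b then f x else 0)] (mod int p)" if a: "a < p" for a
    proof (cases "a = b")
      case True
      have "[x = int a] (mod int p)" using b True by (simp add: cong_def)
      then have "int p dvd x - int a" by (simp add: cong_iff_dvd_diff)
      then have "int p dvd (x - int a) ^ (p - 1)"
        by (rule dvd_trans) (use p1 in \<open>simp add: dvd_power\<close>)
      then have "[f (int a) * (1 - (x - int a) ^ (p - 1)) = f x * (1 - 0)] (mod int p)"
        using f \<open>[x = int a] (mod int p)\<close>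
        by (intro cong_mult cong_diff) (auto simp: cong_0_iff cong_sym)
      then show ?thesis using True by (simp add: g_def)
    next
      case False
      have "\<not> int p dvd x - int a"
        using False a b(2) by (simp add: cong_iff_dvd_diff[symmetric] cong_def)
      then have "[(x - int a) ^ (p - 1) = 1] (mod int p)"
        using fermat_theorem_int[OF p] by blast
      then have "[f (int a) * (1 - (x - int a) ^ (p - 1)) = f (int a) * (1 - 1)] (mod int p)"
        by (intro cong_mult cong_diff) auto
      then show ?thesis using False by (simp add: g_def)
    qed
    then have "[(\<Sum>a<p. poly (g a) x) = (\<Sum>a<p. if a = b then f x else 0)] (mod int p)"
      by (intro cong_sum) auto
    then show ?thesis
      using b by (simp add: poly_sum cong_sym)
  qed
qed

lemma zero_or_has_degree_mod:
  assumes p: "prime p" and f: "\<And>x y. [x = y] (mod int p) \<Longrightarrow> [f x = f y] (mod int p)"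
  shows "(\<forall>x. [f x = 0] (mod int p)) \<or> (\<exists>d<p. has_degree_mod p f d)"
proof -
  obtain q :: "int poly" where q: "degree q < p" "\<And>x. [f x = poly q x] (mod int p)"
    using poly_interpolation_mod[OF p, of f] f by blast
  \<comment> \<open>The leading coefficient of \<open>q\<close> may be divisible by
    \<open>p\<close>. Reducing all coefficients into the range from 0 to \<open>p - 1\<close>
    discards such terms, so a nonzero leading coefficient of \<open>r\<close> is prime to
    \<open>p\<close>.\<close>
  define r where "r = map_poly (\<lambda>c. c mod int p) q"
  have "[poly (map_poly (\<lambda>c. c mod int p) s) x = poly s x] (mod int p)" for s x
  proof (induction s)
    case (pCons a s)
    have "map_poly (\<lambda>c. c mod int p) (pCons a s) = pCons (a mod int p) (map_poly (\<lambda>c. c mod int p) s)"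
      by (simp add: map_poly_pCons)
    then show ?case
      using pCons(2) by (auto intro!: cong_add cong_mult)
  qed simp
  then have r: "[f x = poly r x] (mod int p)" for x
    using q(2) by (metis cong_sym cong_trans r_def)
  show ?thesis
  proof (cases "r = 0")
    case True
    then show ?thesis using r by simp
  next
    case False
    have "lead_coeff r = coeff q (degree r) mod int p"
      by (simp add: r_def coeff_map_poly)
    then have "\<not> int p dvd lead_coeff r"
      using False by (auto simp: dvd_eq_mod_eq_0)
    moreover have "degree r < p"
      using q(1) degree_le[of "degree q" r] by (simp add: r_def coeff_map_poly coeff_eq_0)
    ultimately show ?thesis
      using r by (auto simp: has_degree_mod_def)
  qed
qed

section \<open>Sums over shifts and their effect on degrees\<close>

text \<open>Binomial expansion of each \<open>(x + u) ^ j\<close> confines the dependence on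
  \<open>U\<close> to the power sums of its elements.\<close>

lemma shift_sum_expand:
  fixes q :: "int poly" and U :: "int set"
  shows "(\<Sum>u\<in>U. poly q (x + u)) =
    (\<Sum>j\<le>degree q. \<Sum>i\<le>j. coeff q j * int (j choose i) * (\<Sum>u\<in>U. u ^ i) * x ^ (j - i))"
proof -
  have "poly q (x + u) =
    (\<Sum>j\<le>degree q. \<Sum>i\<le>j. coeff q j * int (j choose i) * u ^ i * x ^ (j - i))" for u
    unfolding poly_altdef
    by (intro sum.cong refl) (subst add.commute, simp add: binomial_ring sum_distrib_left mult_ac)
  then have "(\<Sum>u\<in>U. poly q (x + u)) =
    (\<Sum>u\<in>U. \<Sum>j\<le>degree q. \<Sum>i\<le>j. coeff q j * int (j choose i) * u ^ i * x ^ (j - i))"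
    by simp
  also have "\<dots> = (\<Sum>j\<le>degree q. \<Sum>u\<in>U. \<Sum>i\<le>j. coeff q j * int (j choose i) * u ^ i * x ^ (j - i))"
    by (rule sum.swap)
  also have "\<dots> = (\<Sum>j\<le>degree q. \<Sum>i\<le>j. \<Sum>u\<in>U. coeff q j * int (j choose i) * u ^ i * x ^ (j - i))"
    by (intro sum.cong refl sum.swap)
  finally show ?thesis
    by (simp add: sum_distrib_left sum_distrib_right mult_ac)
qed

text \<open>Subtracting \<open>card U\<close> copies of \<open>f\<close> cancels the terms with
  \<open>i = 0\<close> in the expansion of the shift sum, so only power sums with positive exponent
  remain.\<close>

definition shift_defect :: "int set \<Rightarrow> (int \<Rightarrow> int) \<Rightarrow> int \<Rightarrow> int" where
  "shift_defect U f x = (\<Sum>u\<in>U. f (x + u)) - int (card U) * f x"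

text \<open>The top surviving term is the leading coefficient times \<open>d choose r\<close> times
  the \<open>r\<close>-th power sum, in degree \<open>d - r\<close>. It is nonzero modulo
  \<open>p\<close> because \<open>d < p\<close> keeps the binomial coefficient prime to
  \<open>p\<close>.\<close>

lemma has_degree_mod_shift_defect:
  assumes p: "prime p" and f: "has_degree_mod p f d" and "d < p"
    and S: "\<And>i. 0 < i \<Longrightarrow> i < r \<Longrightarrow> int p dvd (\<Sum>u\<in>U. u ^ i)"
    and r: "0 < r" "\<not> int p dvd (\<Sum>u\<in>U. u ^ r)"
  shows "d < r \<Longrightarrow> [shift_defect U f x = 0] (mod int p)"
    and "r \<le> d \<Longrightarrow> has_degree_mod p (shift_defect U f) (d - r)"
proof -
  obtain q where q: "degree q = d" "\<not> int p dvd lead_coeff q" "\<And>x. [f x = poly q x] (mod int p)"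
    using f by (auto simp: has_degree_mod_def)
  define c where "c = (\<lambda>j i. coeff q j * int (j choose i) * (\<Sum>u\<in>U. u ^ i))"
  \<comment> \<open>Only the terms with \<open>i\<close> at least \<open>r\<close> are kept:
    \<open>i = 0\<close> is cancelled by the subtraction, and the power sums strictly between vanish
    modulo \<open>p\<close>.\<close>
  define s where "s = (\<Sum>j\<le>d. \<Sum>i\<in>{r..j}. monom (c j i) (j - i))"
  have fs: "[shift_defect U f x = poly s x] (mod int p)" for x
  proof -
    have "[shift_defect U f x = (\<Sum>u\<in>U. poly q (x + u)) - int (card U) * poly q x] (mod int p)"
      unfolding shift_defect_def by (intro cong_diff cong_sum cong_mult q cong_refl)
    also have "(\<Sum>u\<in>U. poly q (x + u)) - int (card U) * poly q x =
        (\<Sum>j\<le>d. (\<Sum>i\<le>j. c j i * x ^ (j - i)) - c j 0 * x ^ j)"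
      unfolding shift_sum_expand q(1) sum_subtractf
      by (simp add: c_def poly_altdef q(1) sum_distrib_left mult_ac)
    also have "[\<dots> = (\<Sum>j\<le>d. \<Sum>i\<in>{r..j}. c j i * x ^ (j - i))] (mod int p)"
    proof (rule cong_sum)
      fix j
      have "(\<Sum>i\<le>j. c j i * x ^ (j - i)) = c j 0 * x ^ j + (\<Sum>i\<in>{1..j}. c j i * x ^ (j - i))"
        by (simp add: sum.atMost_shift atMost_atLeast0 sum.atLeast_Suc_atMost)
      moreover have "[(\<Sum>i\<in>{1..j}. c j i * x ^ (j - i)) =
          (\<Sum>i\<in>{1..j}. if r \<le> i then c j i * x ^ (j - i) else 0)] (mod int p)"
        by (rule cong_sum) (auto simp: c_def cong_0_iff S)
      moreover have "(\<Sum>i\<in>{1..j}. if r \<le> i then c j i * x ^ (j - i) else 0) =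
          (\<Sum>i\<in>{r..j}. c j i * x ^ (j - i))"
        using r(1) by (intro sum.mono_neutral_cong_right) auto
      ultimately show "[(\<Sum>i\<le>j. c j i * x ^ (j - i)) - c j 0 * x ^ j =
          (\<Sum>i\<in>{r..j}. c j i * x ^ (j - i))] (mod int p)"
        by simp
    qed
    also have "(\<Sum>j\<le>d. \<Sum>i\<in>{r..j}. c j i * x ^ (j - i)) = poly s x"
      by (simp add: s_def poly_sum poly_monom)
    finally show ?thesis .
  qed
  {
    assume "d < r"
    then have "s = 0" by (simp add: s_def)
    then show "[shift_defect U f x = 0] (mod int p)"
      using fs[of x] by simp
  }
  {
    assume rd: "r \<le> d"
    have deg: "degree s \<le> d - r"
      unfolding s_def
      by (intro degree_sum_le) (auto intro!: degree_sum_le order.trans[OF degree_monom_le])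
    \<comment> \<open>With \<open>j\<close> at most \<open>d\<close> and \<open>i\<close> at least
      \<open>r\<close>, the exponent \<open>j - i\<close> reaches \<open>d - r\<close> only for
      \<open>j = d\<close> and \<open>i = r\<close>.\<close>
    have "coeff s (d - r) = (\<Sum>j\<le>d. \<Sum>i\<in>{r..j}. if j = d \<and> i = r then c d r else 0)"
      unfolding s_def coeff_sum
      by (intro sum.cong refl) auto
    also have "\<dots> = (\<Sum>j\<le>d. if j = d then c d r else 0)"
      using rd by (intro sum.cong refl) auto
    finally have cs: "coeff s (d - r) = c d r"
      by simp
    have "\<not> p dvd (d choose r)"
    proof
      assume "p dvd (d choose r)"
      moreover have "(d choose r) dvd fact d"
        using rd by (metis binomial_fact_lemma dvd_triv_right)
      ultimately have "p dvd fact d" by (rule dvd_trans)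
      then show False using p \<open>d < p\<close> by (simp add: prime_dvd_fact_iff)
    qed
    then have "\<not> int p dvd c d r"
      using p q(1,2) r(2) unfolding c_def
      by (metis int_dvd_int_iff prime_dvd_mult_iff prime_nat_int_transfer)
    moreover from this have "degree s = d - r"
      using deg cs by (metis dvd_0_right le_degree le_antisym)
    ultimately show "has_degree_mod p (shift_defect U f) (d - r)"
      using fs cs unfolding has_degree_mod_def by metis
  }
qed

section \<open>Power sums of nonzero residues\<close>

text \<open>If the first \<open>card U\<close> power sums all vanished modulo \<open>p\<close>, so
  would the sum over \<open>U\<close> of the values of every polynomial with zero constant term and
  degree at most \<open>card U\<close>. A polynomial supported on a single point of \<open>U\<close>
  contradicts this.\<close>

lemma nonvanishing_power_sum:
  fixes U :: "int set"
  assumes p: "prime p" and U: "U \<subseteq> {0<..<int p}" "U \<noteq> {}"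
  obtains r where "0 < r" "r \<le> card U" "\<not> int p dvd (\<Sum>u\<in>U. u ^ r)"
    "\<And>i. 0 < i \<Longrightarrow> i < r \<Longrightarrow> int p dvd (\<Sum>u\<in>U. u ^ i)"
proof -
  have fin: "finite U" using U(1) finite_subset by blast
  have ip: "prime (int p)" using p by simp
  define P where "P r \<longleftrightarrow> 0 < r \<and> r \<le> card U \<and> \<not> int p dvd (\<Sum>u\<in>U. u ^ r)" for r
  have "\<exists>r. P r"
  proof (rule ccontr)
    assume "\<not> ?thesis"
    then have *: "int p dvd (\<Sum>u\<in>U. u ^ r)" if "0 < r" "r \<le> card U" for r
      using that by (auto simp: P_def)
    obtain v where v: "v \<in> U" using U by blast
    \<comment> \<open>The factor \<open>X\<close> kills the constant term, and on \<open>U\<close>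
      only the value at \<open>v\<close> survives. That value is prime to \<open>p\<close> because
      the elements of \<open>U\<close> are nonzero and pairwise distinct modulo
      \<open>p\<close>.\<close>
    define g :: "int poly" where "g = [:0, 1:] * (\<Prod>u\<in>U - {v}. [:- u, 1:])"
    have "degree (\<Prod>u\<in>U - {v}. [:- u, 1:]) \<le> card (U - {v})"
      by (rule order.trans[OF degree_prod_sum_le]) (use fin in auto)
    then have dg: "degree g \<le> card U"
      unfolding g_def
      by (intro order.trans[OF degree_mult_le]) (use v fin card_gt_0_iff[of U] in auto)
    have "(\<Sum>u\<in>U. poly g u) = (\<Sum>i\<le>degree g. coeff g i * (\<Sum>u\<in>U. u ^ i))"
      unfolding poly_altdef by (subst sum.swap) (simp add: sum_distrib_left)
    moreover have "int p dvd coeff g i * (\<Sum>u\<in>U. u ^ i)" if "i \<le> degree g" for i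
    proof (cases "i = 0")
      case True
      then show ?thesis by (simp add: g_def)
    next
      case False
      then show ?thesis using * that dg by simp
    qed
    ultimately have "int p dvd (\<Sum>u\<in>U. poly g u)"
      by (metis (no_types, lifting) atMost_iff dvd_sum)
    also have "(\<Sum>u\<in>U. poly g u) = (\<Sum>u\<in>{v}. poly g u)"
      using fin v by (intro sum.mono_neutral_right) (auto simp: g_def poly_prod)
    finally have "int p dvd v * (\<Prod>u\<in>U - {v}. v - u)"
      by (simp add: g_def poly_prod)
    then have "int p dvd v \<or> (\<exists>u\<in>U - {v}. int p dvd v - u)"
      using ip fin by (simp add: prime_dvd_mult_iff prime_dvd_prod_iff)
    then show False
    proof
      assume "int p dvd v"
      moreover have "0 < v" "v < int p" using v U(1) by auto
      ultimately show False by (simp add: zdvd_not_zless)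
    next
      assume "\<exists>u\<in>U - {v}. int p dvd v - u"
      then obtain u where "u \<in> U" "u \<noteq> v" "[v = u] (mod int p)"
        by (auto simp: cong_iff_dvd_diff)
      then show False
        using U(1) v cong_less_imp_eq_int[of v "int p" u] by force
    qed
  qed
  then obtain r where "P r" "\<And>i. i < r \<Longrightarrow> \<not> P i"
    using exists_least_iff[of P] by blast
  then show ?thesis
    using that[of r] by (force simp: P_def)
qed

section \<open>Permutation groups of prime degree\<close>

text \<open>Put \<open>S i = (\<Sum>u\<in>U. u ^ i)\<close> and let \<open>r\<close> be the least positive index with \<open>S r \<noteq> 0\<close>. Invariance of
  the differences gives \<open>shift_defect U (f ^ k) = (\<Sum>i = r..k. (k choose i) * S i * f ^ (k - i))\<close>, which
  vanishes for \<open>k < r\<close> and is a nonzero constant for \<open>k = r\<close>. As \<open>shift_defect U\<close> lowers degrees by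
  \<open>r\<close>, the reduced power \<open>f ^ k\<close> has degree less than \<open>r\<close> if \<open>k < r\<close> and exactly \<open>r\<close> if \<open>k = r\<close>.
  No degree of \<open>f\<close> above 1 is compatible with this.\<close>

lemma affine_if_preserves_differences:
  fixes U :: "int set"
  assumes p: "prime p" and f: "\<And>x y. [x = y] (mod int p) \<Longrightarrow> [f x = f y] (mod int p)"
    and U: "U \<subseteq> {0<..<int p}" "U \<noteq> {}" "2 * card U < p"
    and bij: "\<And>x. bij_betw (\<lambda>u. (f (x + u) - f x) mod int p) U U"
  obtains a b where "\<And>x. [f x = a * x + b] (mod int p)"
proof -
  obtain r where r: "0 < r" "r \<le> card U" "\<not> int p dvd (\<Sum>u\<in>U. u ^ r)"
    "\<And>i. 0 < i \<Longrightarrow> i < r \<Longrightarrow> int p dvd (\<Sum>u\<in>U. u ^ i)"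
    using nonvanishing_power_sum[OF p U(1,2)] by blast
  define S where "S = (\<lambda>i. \<Sum>u\<in>U. u ^ i)"
  have diffs: "[(\<Sum>u\<in>U. (f (x + u) - f x) ^ k) = S k] (mod int p)" for x k
  proof -
    have "S k = (\<Sum>u\<in>U. ((f (x + u) - f x) mod int p) ^ k)"
      unfolding S_def by (rule sum.reindex_bij_betw[OF bij, symmetric])
    also have "[\<dots> = (\<Sum>u\<in>U. (f (x + u) - f x) ^ k)] (mod int p)"
      by (intro cong_sum cong_pow) (simp add: cong_def)
    finally show ?thesis by (rule cong_sym)
  qed
  have "(\<Sum>u\<in>U. f (x + u) ^ k) =
      (\<Sum>i\<le>k. int (k choose i) * f x ^ (k - i) * (\<Sum>u\<in>U. (f (x + u) - f x) ^ i))" for x k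
  proof -
    have "f (x + u) ^ k = (\<Sum>i\<le>k. int (k choose i) * f x ^ (k - i) * (f (x + u) - f x) ^ i)" for u
      using binomial_ring[of "f (x + u) - f x" "f x" k] by (simp add: mult_ac)
    then have "(\<Sum>u\<in>U. f (x + u) ^ k) =
        (\<Sum>u\<in>U. \<Sum>i\<le>k. int (k choose i) * f x ^ (k - i) * (f (x + u) - f x) ^ i)"
      by simp
    also have "\<dots> = (\<Sum>i\<le>k. \<Sum>u\<in>U. int (k choose i) * f x ^ (k - i) * (f (x + u) - f x) ^ i)"
      by (rule sum.swap)
    finally show ?thesis
      by (simp add: sum_distrib_left)
  qed
  then have pow: "[(\<Sum>u\<in>U. f (x + u) ^ k) = (\<Sum>i\<le>k. int (k choose i) * f x ^ (k - i) * S i)] (mod int p)"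
    for x k
    by (simp only:) (intro cong_sum cong_mult cong_refl diffs)
  have defect: "[shift_defect U (\<lambda>x. f x ^ k) x = (if k = r then S r else 0)] (mod int p)"
    if k: "0 < k" "k \<le> r" for x k
  proof -
    have "[(\<Sum>u\<in>U. f (x + u) ^ k) = (\<Sum>i\<le>k. int (k choose i) * f x ^ (k - i) * S i)] (mod int p)"
      by (rule pow)
    also have "(\<Sum>i\<le>k. int (k choose i) * f x ^ (k - i) * S i) =
        int (card U) * f x ^ k + (\<Sum>i\<in>{1..k}. int (k choose i) * f x ^ (k - i) * S i)"
      by (simp add: atMost_atLeast0 sum.atLeast_Suc_atMost S_def)
    also have "[\<dots> = int (card U) * f x ^ k + (\<Sum>i\<in>{1..k}. if i = r then S r else 0)] (mod int p)"
      using k by (intro cong_add cong_refl cong_sum) (auto simp: S_def cong_0_iff r)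
    also have "(\<Sum>i\<in>{1..k}. if i = r then S r else 0) = (if k = r then S r else 0)"
      using k by (auto simp: sum.delta)
    finally have "[(\<Sum>u\<in>U. f (x + u) ^ k) =
        int (card U) * f x ^ k + (if k = r then S r else 0)] (mod int p)" .
    then show ?thesis
      unfolding shift_defect_def by (simp add: cong_iff_dvd_diff algebra_simps)
  qed
  note ld = has_degree_mod_shift_defect[OF p _ _ r(4,1,3)]
  have less: "d < r" if "0 < k" "k < r" "has_degree_mod p (\<lambda>x. f x ^ k) d" "d < p" for k d
  proof (rule ccontr)
    assume "\<not> d < r"
    then have "has_degree_mod p (shift_defect U (\<lambda>x. f x ^ k)) (d - r)"
      using ld(2)[OF that(3,4)] by simp
    then obtain x where "\<not> [shift_defect U (\<lambda>x. f x ^ k) x = 0] (mod int p)"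
      using has_degree_mod_not_zero[OF p] \<open>d < p\<close> by (meson less_imp_diff_less)
    then show False
      using defect[of k x] that(1,2) by simp
  qed
  have eq: "d = r" if "has_degree_mod p (\<lambda>x. f x ^ r) d" "d < p" for d
  proof -
    have c: "[shift_defect U (\<lambda>x. f x ^ r) x = S r] (mod int p)" for x
      using defect[of r x] r(1) by simp
    have "\<not> d < r"
    proof
      assume "d < r"
      then have "[S r = 0] (mod int p)"
        using ld(1)[OF that] c by (metis cong_sym cong_trans)
      then show False using r(3) by (simp add: S_def cong_0_iff)
    qed
    moreover from this have "d - r = 0"
      using has_degree_mod_unique[OF p ld(2)[OF that] has_degree_mod_const[OF _ c]] r(3) that(2)
      by (simp add: S_def)
    ultimately show ?thesis by simp
  qed
  consider "\<forall>x. [f x = 0] (mod int p)" | n where "n < p" "has_degree_mod p f n"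
    using zero_or_has_degree_mod[OF p, of f] f by blast
  then show ?thesis
  proof cases
    case 1
    then show ?thesis using that[of 0 0] by simp
  next
    case 2
    have "n \<le> 1"
    proof (rule ccontr)
      assume n: "\<not> n \<le> 1"
      \<comment> \<open>For \<open>r = 1\<close> the exponent 1 already falls under
        \<open>eq\<close>, which would give \<open>n = 1\<close>.\<close>
      have "r \<noteq> 1"
        using eq[of n] 2 n by auto
      then have "n < r"
        using less[of 1 n] 2 r(1) by simp
      \<comment> \<open>\<open>k\<close> is \<open>r / n\<close> rounded up, so \<open>k * n\<close>
        is the first multiple of \<open>n\<close> that reaches \<open>r\<close>. Since
        \<open>n < r\<close>, it stays below \<open>2 * r\<close>, hence below \<open>p\<close> by
        the bound on \<open>card U\<close>, and degrees are still unique there.\<close>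
      define k where "k = Suc ((r - 1) div n)"
      have "(r - 1) div n * n \<le> r - 1" by (rule div_times_less_eq_dividend)
      then have kn: "r \<le> k * n" "k * n \<le> r - 1 + n"
        using n dividend_less_div_times[of n "r - 1"] by (auto simp: k_def)
      have "k \<le> r"
        using r(1) div_le_dividend[of "r - 1" n] unfolding k_def by linarith
      have knp: "k * n < p"
        using kn(2) \<open>n < r\<close> r(2) U(3) by linarith
      have deg: "has_degree_mod p (\<lambda>x. f x ^ k) (k * n)"
        using has_degree_mod_power[OF p 2(2)] .
      show False
      \<comment> \<open>If \<open>k = r\<close>, the degree \<open>r * n\<close> exceeds the value
        \<open>r\<close> forced by \<open>eq\<close>; if \<open>k < r\<close>, the degree
        \<open>k * n\<close> is at least \<open>r\<close>, against \<open>less\<close>.\<close>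
      proof (cases "k = r")
        case True
        then show False using eq[of "r * n"] deg knp n r(1) by simp
      next
        case False
        then show False using less[of k "k * n"] deg knp kn(1) \<open>k \<le> r\<close> by (simp add: k_def)
      qed
    qed
    obtain q where q: "degree q = n" "\<And>x. [f x = poly q x] (mod int p)"
      using 2 by (auto simp: has_degree_mod_def)
    obtain b a where "q = [:b, a:]"
      using q(1) \<open>n \<le> 1\<close> degree1_coeffs[of q] degree_eq_zeroE[of q]
      by (metis le_numeral_extra(4) le_neq_implies_less less_one pCons_0_0)
    then show ?thesis
      using q(2) that[of a b] by (simp add: algebra_simps)
  qed
qed

text \<open>Only closure under composition is assumed, without identity or inverses, so every
  translation is obtained as a positive power of \<open>c\<close>.\<close>

lemma all_translations:
  assumes p: "0 < p" and closed: "\<And>g h. g \<in> G \<Longrightarrow> h \<in> G \<Longrightarrow> g \<circ> h \<in> G"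
    and c: "c \<in> G" "\<And>i. i < p \<Longrightarrow> c i = Suc i mod p"
  obtains g where "g \<in> G" "\<And>i. i < p \<Longrightarrow> int (g i) = (int i + e) mod int p"
proof -
  have "\<exists>g\<in>G. \<forall>i<p. g i = (i + Suc k) mod p" for k
  proof (induction k)
    case 0
    then show ?case using c by auto
  next
    case (Suc k)
    then obtain g where "g \<in> G" "\<And>i. i < p \<Longrightarrow> g i = (i + Suc k) mod p" by blast
    then show ?case
      using closed[OF c(1), of g] c(2) p by (intro bexI[of _ "c \<circ> g"]) (auto simp: mod_Suc_eq)
  qed
  \<comment> \<open>The exponent equals \<open>e mod p + p\<close>, which is positive and congruent
    to \<open>e\<close>.\<close>
  then obtain g where g: "g \<in> G" "\<And>i. i < p \<Longrightarrow> g i = (i + Suc (nat (e mod int p) + (p - 1))) mod p"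
    by blast
  have "int (g i) = (int i + e) mod int p" if "i < p" for i
  proof -
    have "int (g i) = (int i + e mod int p + int p) mod int p"
      using g(2)[OF that] p by (simp add: zmod_int of_nat_diff algebra_simps)
    then show ?thesis by (simp add: mod_simps)
  qed
  then show ?thesis using g(1) that by blast
qed

text \<open>The differences \<open>U\<close> along an orbit on pairs are preserved by \<open>G\<close>, and so is the complement
  of \<open>U\<close> in the nonzero residues; one of the two sets has fewer than \<open>p / 2\<close> elements.\<close>

theorem card_le_if_not_two_transitive:
  assumes p: "prime p" and perm: "\<And>g. g \<in> G \<Longrightarrow> g permutes {..<p}"
    and closed: "\<And>g h. g \<in> G \<Longrightarrow> h \<in> G \<Longrightarrow> g \<circ> h \<in> G"
    and cyc: "c \<in> G" "\<And>i. i < p \<Longrightarrow> c i = Suc i mod p"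
    and not2: "\<not> two_transitive_on G {..<p}"
  shows "card G \<le> p * (p - 1)"
proof -
  have p0: "0 < p" "1 < p" using prime_gt_0_nat[OF p] prime_gt_1_nat[OF p] .
  have lt: "g i < p" if "g \<in> G" "i < p" for g i
    using permutes_in_image[OF perm[OF that(1)], of i] that(2) by simp
  note trans = all_translations[OF p0(1) closed cyc]
  obtain a b c d where abcd: "a < p" "b < p" "c < p" "d < p" "a \<noteq> b" "c \<noteq> d"
    "\<And>g. g \<in> G \<Longrightarrow> \<not> (g a = c \<and> g b = d)"
    using not2 by (auto simp: two_transitive_on_def)
  define R where "R = {0<..<int p}"
  define U where "U = (\<lambda>g. (int (g b) - int (g a)) mod int p) ` G"
  \<comment> \<open>This is the \<open>p\<close>-periodic extension of \<open>s\<close> to the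
    integers, the form in which the polynomial argument takes its functions.\<close>
  define f where "f = (\<lambda>s x. int (s (nat (x mod int p))))" for s :: "nat \<Rightarrow> nat"
  have f_cong: "f s x = f s y" if "[x = y] (mod int p)" for s x y
    using that by (simp add: f_def cong_def)
  have f_nat: "f s (int i) = int (s i)" if "i < p" for s i
    using that by (simp add: f_def)
  have f_range: "0 \<le> f s x" "f s x < int p" if "s \<in> G" for s x
    using lt[OF that, of "nat (x mod int p)"] p0 by (auto simp: f_def nat_less_iff)
  have f_inj: "[x = y] (mod int p)" if "s \<in> G" "[f s x = f s y] (mod int p)" for s x y
  proof -
    have "f s x = f s y"
      using that f_range by (metis cong_less_imp_eq_int)
    then have "nat (x mod int p) = nat (y mod int p)"
      using permutes_inj[OF perm[OF that(1)]] by (simp add: f_def inj_eq)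
    then show ?thesis
      using p0 by (simp add: cong_def nat_eq_iff)
  qed
  have bij_R: "bij_betw (\<lambda>u. (f s (x + u) - f s x) mod int p) R R" if s: "s \<in> G" for s x
  proof -
    have "inj_on (\<lambda>u. (f s (x + u) - f s x) mod int p) R"
    proof (rule inj_onI)
      fix u v assume uv: "u \<in> R" "v \<in> R"
        and "(f s (x + u) - f s x) mod int p = (f s (x + v) - f s x) mod int p"
      then have "[f s (x + u) = f s (x + v)] (mod int p)"
        by (simp add: cong_def[symmetric] cong_iff_dvd_diff)
      then have "[x + u = x + v] (mod int p)" using f_inj[OF s] by blast
      then have "[u = v] (mod int p)" by (simp add: cong_add_lcancel)
      then show "u = v" using uv cong_less_imp_eq_int[of u "int p" v] by (simp add: R_def)
    qed
    moreover have "(f s (x + u) - f s x) mod int p \<in> R" if u: "u \<in> R" for u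
    proof -
      have "(f s (x + u) - f s x) mod int p \<noteq> 0"
      proof
        assume "(f s (x + u) - f s x) mod int p = 0"
        then have "[f s (x + u) = f s x] (mod int p)"
          by (simp add: cong_iff_dvd_diff dvd_eq_mod_eq_0)
        then have "[x + u = x] (mod int p)" using f_inj[OF s] by blast
        then have "int p dvd u" by (simp add: cong_iff_dvd_diff)
        then show False using u by (simp add: R_def zdvd_not_zless)
      qed
      moreover have "0 \<le> (f s (x + u) - f s x) mod int p" "(f s (x + u) - f s x) mod int p < int p"
        using p0 by simp_all
      ultimately show ?thesis
        unfolding R_def by simp
    qed
    ultimately show ?thesis
      unfolding bij_betw_def R_def by (intro conjI endo_inj_surj) auto
  qed
  \<comment> \<open>Following a member of \<open>G\<close> by a translation moves the image of
    \<open>a\<close> to any base point without changing the difference. So the orbit of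
    \<open>(a, b)\<close> consists of all pairs whose difference lies in \<open>U\<close>.\<close>
  have transport: "\<exists>h\<in>G. int (h a) = y mod int p \<and> int (h b) = (y + u) mod int p" if u: "u \<in> U" for u y
  proof -
    obtain g where g: "g \<in> G" "u = (int (g b) - int (g a)) mod int p"
      using u by (auto simp: U_def)
    obtain t where t: "t \<in> G" "\<And>i. i < p \<Longrightarrow> int (t i) = (int i + (y - int (g a))) mod int p"
      using trans[of "y - int (g a)"] by blast
    have "int (t (g a)) = y mod int p" "int (t (g b)) = (y + u) mod int p"
      using g abcd(1,2) lt by (simp_all add: t(2) mod_simps algebra_simps)
    then show ?thesis
      using closed[OF t(1) g(1)] by (intro bexI[of _ "t \<circ> g"]) simp_all
  qed
  have U: "U \<subseteq> R"
  proof
    fix u assume "u \<in> U"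
    then obtain g where g: "g \<in> G" "u = (int (g b) - int (g a)) mod int p"
      by (auto simp: U_def)
    have "u \<noteq> 0"
    proof
      assume "u = 0"
      then have "[f g b = f g a] (mod int p)"
        using g(2) abcd(1,2) by (simp add: f_nat cong_iff_dvd_diff dvd_eq_mod_eq_0)
      then have "[int b = int a] (mod int p)" using f_inj[OF g(1)] by blast
      then show False using abcd cong_less_imp_eq_int[of "int b" "int p" "int a"] by simp
    qed
    moreover have "0 \<le> u" "u < int p" using g(2) p0 by simp_all
    ultimately show "u \<in> R" by (simp add: R_def)
  qed
  have fin: "finite R" "finite U"
    using U by (auto simp: R_def intro: finite_subset)
  have bij_U: "bij_betw (\<lambda>u. (f s (x + u) - f s x) mod int p) U U" if s: "s \<in> G" for s x
  proof -
    have "(f s (x + u) - f s x) mod int p \<in> U" if u: "u \<in> U" for u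
    proof -
      obtain h where h: "h \<in> G" "int (h a) = x mod int p" "int (h b) = (x + u) mod int p"
        using transport[OF u] by blast
      have "nat (x mod int p) = h a" "nat ((x + u) mod int p) = h b"
        using h(2,3) by (metis nat_int)+
      then have "f s (x + u) - f s x = int ((s \<circ> h) b) - int ((s \<circ> h) a)"
        by (simp add: f_def)
      then show ?thesis
        unfolding U_def using closed[OF s h(1)] by (intro image_eqI[of _ _ "s \<circ> h"]) simp_all
    qed
    moreover have "inj_on (\<lambda>u. (f s (x + u) - f s x) mod int p) U"
      using bij_R[OF s] U by (meson bij_betw_def inj_on_subset)
    ultimately show ?thesis
      unfolding bij_betw_def using fin by (intro conjI endo_inj_surj) auto
  qed
  have bij_V: "bij_betw (\<lambda>u. (f s (x + u) - f s x) mod int p) (R - U) (R - U)" if s: "s \<in> G" for s x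
    using bij_betw_DiffI[OF bij_R[OF s, of x] bij_U[OF s, of x]] U by simp
  have "U \<noteq> {}" using cyc(1) by (auto simp: U_def)
  \<comment> \<open>Otherwise \<open>transport\<close> with base point \<open>c\<close> would yield
    a member of \<open>G\<close> taking \<open>(a, b)\<close> to \<open>(c, d)\<close>, a pair
    chosen outside the orbit.\<close>
  have "(int d - int c) mod int p \<notin> U"
  proof
    assume "(int d - int c) mod int p \<in> U"
    then obtain h where "h \<in> G" "int (h a) = int c mod int p"
      "int (h b) = (int c + (int d - int c) mod int p) mod int p"
      using transport by blast
    then show False
      using abcd by (simp add: mod_simps)
  qed
  moreover have "(int d - int c) mod int p \<in> R"
  proof -
    have "(int d - int c) mod int p \<noteq> 0"
    proof
      assume "(int d - int c) mod int p = 0"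
      then have "[int d = int c] (mod int p)"
        by (simp add: cong_iff_dvd_diff dvd_eq_mod_eq_0)
      then show False using abcd cong_less_imp_eq_int[of "int d" "int p" "int c"] by simp
    qed
    moreover have "0 \<le> (int d - int c) mod int p" "(int d - int c) mod int p < int p"
      using p0 by simp_all
    ultimately show ?thesis by (simp add: R_def)
  qed
  ultimately have "R - U \<noteq> {}" by blast
  have "card R = p - 1" by (simp add: R_def nat_diff_distrib)
  then have "card U + card (R - U) = p - 1"
    using fin U card_mono[OF fin(1) U] by (simp add: card_Diff_subset)
  then consider "2 * card U < p" | "2 * card (R - U) < p" using p0 by linarith
  then obtain W where W: "W \<subseteq> R" "W \<noteq> {}" "2 * card W < p"
    "\<And>s x. s \<in> G \<Longrightarrow> bij_betw (\<lambda>u. (f s (x + u) - f s x) mod int p) W W"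
    using U \<open>U \<noteq> {}\<close> \<open>R - U \<noteq> {}\<close> bij_U bij_V by (metis Diff_subset)
  have affine: "\<exists>a b. \<forall>x. [f s x = a * x + b] (mod int p)" if s: "s \<in> G" for s
  proof -
    obtain a b where "\<And>x. [f s x = a * x + b] (mod int p)"
    proof (rule affine_if_preserves_differences[OF p _ W(1)[unfolded R_def] W(2,3) W(4)[OF s]])
      show "[f s x = f s y] (mod int p)" if "[x = y] (mod int p)" for x y
        using f_cong[OF that, of s] by simp
    qed blast
    then show ?thesis by blast
  qed
  \<comment> \<open>An affine map is determined by its values at 0 and 1. For a permutation these
    differ, which leaves \<open>p * (p - 1)\<close> pairs.\<close>
  have "inj_on (\<lambda>s. (s 0, s 1)) G"
  proof (rule inj_onI)
    fix s t assume s: "s \<in> G" and t: "t \<in> G" and eq: "(s 0, s 1) = (t 0, t 1)"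
    obtain a b where ab: "\<And>x. [f s x = a * x + b] (mod int p)" using affine[OF s] by blast
    obtain a' b' where ab': "\<And>x. [f t x = a' * x + b'] (mod int p)" using affine[OF t] by blast
    have eqs: "f s 0 = f t 0" "f s 1 = f t 1"
      using eq p0 f_nat[of 0] f_nat[of 1] by simp_all
    have b: "[b = b'] (mod int p)"
      using ab[of 0] ab'[of 0] eqs(1) by (simp, metis cong_sym cong_trans)
    have "[a + b = a' + b'] (mod int p)"
      using ab[of 1] ab'[of 1] eqs(2) by (simp, metis cong_sym cong_trans)
    then have "[(a + b) - b = (a' + b') - b'] (mod int p)"
      by (intro cong_diff b)
    then have "[a * x + b = a' * x + b'] (mod int p)" for x
      by (intro cong_add cong_mult b) simp_all
    then have "[f s x = f t x] (mod int p)" for x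
      using ab ab' by (metis cong_sym cong_trans)
    then have "f s x = f t x" for x
      using f_range s t by (metis cong_less_imp_eq_int)
    then have "s i = t i" if "i < p" for i
      using f_nat[OF that] by (metis of_nat_eq_iff)
    then show "s = t"
      using perm[OF s] perm[OF t] by (metis ext permutes_not_in lessThan_iff)
  qed
  moreover have "(\<lambda>s. (s 0, s 1)) ` G \<subseteq> Sigma {..<p} (\<lambda>x. {..<p} - {x})"
  proof
    fix z assume "z \<in> (\<lambda>s. (s 0, s 1)) ` G"
    then obtain s where s: "s \<in> G" "z = (s 0, s 1)" by blast
    have "s 0 \<noteq> s 1" using permutes_inj[OF perm[OF s(1)]] by (simp add: inj_eq)
    then show "z \<in> Sigma {..<p} (\<lambda>x. {..<p} - {x})" using s lt p0 by auto
  qed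
  ultimately have "card G \<le> card (Sigma {..<p} (\<lambda>x. {..<p} - {x}))"
    by (intro card_inj_on_le) auto
  then show ?thesis by (simp add: card_SigmaI)
qed

section \<open>Column permutations of matrices\<close>

lemma permutes_lessThan_preimage:
  assumes "s permutes {..<n}" "i < n"
  obtains k where "k < n" "s k = i"
  using assms permutes_inverses(1)[of s "{..<n}" i] permutes_in_image[OF permutes_inv, of s "{..<n}" i]
  by (metis lessThan_iff)

lemma distinct_cols_eq:
  assumes "distinct (cols M)" "col M j = col M k" "j < dim_col M" "k < dim_col M"
  shows "j = k"
  using assms nth_eq_iff_index_eq[of "cols M" j k] by simp

text \<open>Translation by 1 permutes the field, so summing over all elements gives
  \<open>of_nat CARD('a) = 0\<close>, and a field has no nonzero nilpotent elements.\<close>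

lemma finite_field_char_2:
  assumes "CARD('a :: {field, finite}) = 2 ^ l"
  shows "(1 :: 'a) + 1 = 0"
proof -
  have "(\<Sum>x\<in>UNIV. x + 1 :: 'a) = (\<Sum>x\<in>UNIV. x)"
    by (rule sum.reindex_bij_betw[of "\<lambda>x. x + 1" UNIV UNIV "\<lambda>x. x"])
       (rule bij_betw_byWitness[of _ "\<lambda>x. x - 1"], auto)
  then have "of_nat CARD('a) = (0 :: 'a)"
    by (simp add: sum.distrib)
  then have "(2 :: 'a) ^ l = 0"
    using assms by simp
  then show ?thesis
    by (simp add: one_add_one)
qed

text \<open>\<open>F2\<close> is only the set of 0 and 1; characteristic 2 is what closes it under
  addition.\<close>

lemma mult_mat_vec_F2:
  fixes A :: "'a :: field mat"
  assumes char: "(1 :: 'a) + 1 = 0" and A: "A \<in> carrier_mat n n" "elements_mat A \<subseteq> F2"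
    and v: "v \<in> carrier_vec n" "\<And>i. i < n \<Longrightarrow> v $ i \<in> F2" and i: "i < n"
  shows "(A *\<^sub>v v) $ i \<in> F2"
proof -
  have "(\<Sum>k\<in>K. A $$ (i, k) * v $ k) \<in> F2" if "K \<subseteq> {0..<n}" for K
    using finite_subset[OF that finite_atLeastLessThan] that
  proof (induction K)
    case empty
    then show ?case by (simp add: F2_def)
  next
    case (insert k K)
    have "A $$ (i, k) \<in> F2"
      using elements_matI[OF A(1) i, of k] insert.prems by (intro subsetD[OF A(2)]) simp
    then show ?case
      using insert v(2)[of k] char by (auto simp: F2_def)
  qed
  then show ?thesis
    using A(1) v(1) i by (simp add: scalar_prod_def)
qed

section \<open>Permuted rows and columns, and membership in T\<close>

lemma index_mult_perm_mat:
  fixes M :: "'a :: field mat"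
  assumes M: "M \<in> carrier_mat r n" and t: "t permutes {..<n}" and ij: "i < r" "j < n"
  shows "(M * perm_mat n t) $$ (i, j) = M $$ (i, t j)"
proof -
  have tj: "t j < n" using permutes_in_image[OF t, of j] ij by simp
  have "(M * perm_mat n t) $$ (i, j) = (\<Sum>k = 0..<n. M $$ (i, k) * (if k = t j then 1 else 0))"
    using M ij by (simp add: perm_mat_def scalar_prod_def)
  also have "\<dots> = (\<Sum>k = 0..<n. if k = t j then M $$ (i, k) else 0)"
    by (rule sum.cong) auto
  finally show ?thesis
    using tj by simp
qed

text \<open>Addressing the row as \<open>s i\<close> avoids the inverse permutation.\<close>

lemma index_perm_mat_mult:
  fixes M :: "'a :: field mat"
  assumes M: "M \<in> carrier_mat n r" and s: "s permutes {..<n}" and ij: "i < n" "j < r"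
  shows "(perm_mat n s * M) $$ (s i, j) = M $$ (i, j)"
proof -
  have si: "s i < n" using permutes_in_image[OF s, of i] ij by simp
  have "(perm_mat n s * M) $$ (s i, j) = (\<Sum>k = 0..<n. (if s i = s k then 1 else 0) * M $$ (k, j))"
    using M ij si by (simp add: perm_mat_def scalar_prod_def)
  also have "\<dots> = (\<Sum>k = 0..<n. if k = i then M $$ (k, j) else 0)"
    using permutes_inj[OF s] by (intro sum.cong refl) (auto simp: inj_eq)
  finally show ?thesis
    using ij by simp
qed

lemma index_perm_mat_mult_both:
  fixes M :: "'a :: field mat"
  assumes M: "M \<in> carrier_mat n r" and s: "s permutes {..<n}" and t: "t permutes {..<r}"
    and ij: "i < n" "j < r"
  shows "(perm_mat n s * M * perm_mat r t) $$ (s i, j) = M $$ (i, t j)"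
proof -
  have "s i < n" "t j < r"
    using permutes_in_image[OF s, of i] permutes_in_image[OF t, of j] ij by auto
  moreover have "perm_mat n s * M \<in> carrier_mat n r"
    using M by (intro mult_carrier_mat[of _ n n]) (auto simp: perm_mat_def)
  ultimately show ?thesis
    using index_mult_perm_mat[OF _ t, of "perm_mat n s * M" n "s i" j]
      index_perm_mat_mult[OF M s ij(1), of "t j"] ij by simp
qed

text \<open>It suffices that every column with permuted rows is again some column of
  \<open>C\<close>: since the columns are distinct, the resulting map on column indices is
  injective, hence a permutation. This removes the permutation matrices from later
  arguments.\<close>

lemma T_group_iff:
  fixes C :: "'a :: field mat"
  assumes C: "C \<in> carrier_mat p n" and dist: "distinct (cols C)"
  shows "s \<in> T_group C \<longleftrightarrow> s permutes {..<p} \<and>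
    (\<forall>j<n. \<exists>k<n. \<forall>i<p. C $$ (s i, j) = C $$ (i, k))"
proof
  assume "s \<in> T_group C"
  then obtain t where s: "s permutes {..<p}" and t: "t permutes {..<n}"
    and eq: "perm_mat p s * C * perm_mat n t = C"
    using C by (auto simp: T_group_def)
  have "\<forall>i<p. C $$ (s i, j) = C $$ (i, t j)" if "j < n" for j
    using index_perm_mat_mult_both[OF C s t _ that] unfolding eq by blast
  moreover have "t j < n" if "j < n" for j
    using permutes_in_image[OF t, of j] that by simp
  ultimately show "s permutes {..<p} \<and> (\<forall>j<n. \<exists>k<n. \<forall>i<p. C $$ (s i, j) = C $$ (i, k))"
    using s by blast
next
  assume *: "s permutes {..<p} \<and> (\<forall>j<n. \<exists>k<n. \<forall>i<p. C $$ (s i, j) = C $$ (i, k))"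
  then have s: "s permutes {..<p}" by blast
  from * obtain t0 where t0: "\<And>j. j < n \<Longrightarrow> t0 j < n"
    "\<And>i j. j < n \<Longrightarrow> i < p \<Longrightarrow> C $$ (s i, j) = C $$ (i, t0 j)"
    by metis
  have "inj_on t0 {..<n}"
  proof (rule inj_onI)
    fix j k assume jk: "j \<in> {..<n}" "k \<in> {..<n}" "t0 j = t0 k"
    have "C $$ (i, j) = C $$ (i, k)" if "i < p" for i
    proof -
      obtain i' where "i' < p" "s i' = i"
        by (rule permutes_lessThan_preimage[OF s \<open>i < p\<close>])
      then show ?thesis
        using t0(2)[of j i'] t0(2)[of k i'] jk(3) jk(1,2)[unfolded lessThan_iff] by (simp only:)
    qed
    then have "col C j = col C k"
      using C jk by (intro eq_vecI) auto
    then show "j = k"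
      using distinct_cols_eq[OF dist, of j k] C jk by simp
  qed
  then have bij: "bij_betw t0 {..<n} {..<n}"
    using t0(1) unfolding bij_betw_def by (intro conjI endo_inj_surj) auto
  define t where "t = (\<lambda>j. if j < n then t0 j else j)"
  have t: "t permutes {..<n}"
    using bij by (intro bij_imp_permutes) (auto simp: t_def bij_betw_def inj_on_def)
  have "perm_mat p s * C * perm_mat n t = C"
  proof (rule eq_matI)
    fix i j assume "i < dim_row C" "j < dim_col C"
    then have ij: "i < p" "j < n" using C by auto
    obtain i' where i': "i' < p" "s i' = i"
      by (rule permutes_lessThan_preimage[OF s ij(1)])
    have "C $$ (i', t j) = C $$ (i, j)"
      using t0(2)[OF ij(2) i'(1)] i'(2) ij(2) by (simp only: t_def if_True)
    then show "(perm_mat p s * C * perm_mat n t) $$ (i, j) = C $$ (i, j)"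
      using index_perm_mat_mult_both[OF C s t i'(1) ij(2)] i'(2) by (simp only:)
  qed (use C in \<open>auto simp: perm_mat_def\<close>)
  then show "s \<in> T_group C"
    using s t C by (auto simp: T_group_def)
qed

lemma comp_in_T_group:
  assumes C: "C \<in> carrier_mat p n" "distinct (cols C)" and g: "g \<in> T_group C" and h: "h \<in> T_group C"
  shows "g \<circ> h \<in> T_group C"
  unfolding T_group_iff[OF C]
proof (intro conjI allI impI)
  note g = g[unfolded T_group_iff[OF C]] and h = h[unfolded T_group_iff[OF C]]
  show "g \<circ> h permutes {..<p}" using g h permutes_compose by blast
  fix j assume "j < n"
  then obtain k where k: "k < n" "\<And>i. i < p \<Longrightarrow> C $$ (g i, j) = C $$ (i, k)" using g by blast
  then obtain l where l: "l < n" "\<And>i. i < p \<Longrightarrow> C $$ (h i, k) = C $$ (i, l)" using h by blast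
  have "h i < p" if "i < p" for i
    using that permutes_in_image[of h "{..<p}" i] h by simp
  then have "C $$ ((g \<circ> h) i, j) = C $$ (i, l)" if "i < p" for i
    using k(2)[of "h i"] l(2)[of i] that by simp
  then show "\<exists>l<n. \<forall>i<p. C $$ ((g \<circ> h) i, j) = C $$ (i, l)"
    using l(1) by blast
qed

section \<open>Circulant matrices and their concatenation\<close>

lemma circulant_shift:
  assumes "circulant n M" "i < n" "j < n"
  shows "M $$ (i, (i + j) mod n) = M $$ (0, j)"
  using assms(2)
proof (induction i)
  case 0
  then show ?case using assms(3) by simp
next
  case (Suc i)
  have "M $$ (Suc i, Suc ((i + j) mod n) mod n) = M $$ (i, (i + j) mod n)"
    using assms(1) Suc.prems by (simp add: circulant_def)
  then show ?case using Suc by (simp add: mod_Suc_eq)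
qed

text \<open>The definition does not state the step from the last row back to the first. It holds
  because both positions lie on the same cyclic diagonal, along which the entry is that of row
  0.\<close>

lemma circulant_cycle:
  assumes M: "circulant n M" and ij: "i < n" "j < n"
  shows "M $$ (Suc i mod n, Suc j mod n) = M $$ (i, j)"
proof -
  \<comment> \<open>This is \<open>j - i\<close> modulo \<open>n\<close>, written so that the
    subtraction is not truncated.\<close>
  define k where "k = (j + (n - i)) mod n"
  have k: "k < n" "(i + k) mod n = j"
    using ij by (auto simp: k_def mod_simps)
  have "(Suc i mod n + k) mod n = Suc j mod n"
    using k by (metis add_Suc mod_Suc_eq mod_add_left_eq)
  then show ?thesis
    using circulant_shift[OF M, of "Suc i mod n" k] circulant_shift[OF M, of i k] ij k by simp
qed

text \<open>Every cyclic diagonal meets every column, so each entry of \<open>M\<close> occurs in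
  each column. Here \<open>k\<close> names the diagonal of \<open>x\<close>, and \<open>i\<close>
  the row where it meets column \<open>j\<close>.\<close>

lemma circulant_col_not_F2:
  fixes M :: "'a :: field mat"
  assumes M: "circulant n M" and x: "x \<in> elements_mat M" "x \<notin> F2" and j: "j < n"
  obtains i where "i < n" "M $$ (i, j) \<notin> F2"
proof -
  have dim: "dim_row M = n" "dim_col M = n" using M by (auto simp: circulant_def)
  obtain a b where ab: "a < n" "b < n" "x = M $$ (a, b)"
    using x(1) dim by (auto simp: elements_mat_def)
  define k where "k = (b + (n - a)) mod n"
  have k: "k < n" "(a + k) mod n = b" using ab by (auto simp: k_def mod_simps)
  define i where "i = (j + (n - k)) mod n"
  have i: "i < n" "(i + k) mod n = j" using j k by (auto simp: i_def mod_simps)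
  have "M $$ (i, j) = x"
    using circulant_shift[OF M i(1) k(1)] circulant_shift[OF M ab(1) k(1)] i k ab(3) by simp
  then show ?thesis using that[OF i(1)] x(2) by simp
qed

lemma nth_concat_uniform:
  assumes "\<And>xs. xs \<in> set xss \<Longrightarrow> length xs = p" "k < length xss" "c < p"
  shows "concat xss ! (k * p + c) = xss ! k ! c"
  using assms
proof (induction xss arbitrary: k)
  case (Cons xs xss)
  then show ?case by (cases k) (auto simp: nth_append)
qed simp

lemma hcat_blocks:
  assumes "\<And>D. D \<in> set Ds \<Longrightarrow> D \<in> carrier_mat r p"
  shows "hcat r Ds \<in> carrier_mat r (length Ds * p)"
    and "k < length Ds \<Longrightarrow> i < r \<Longrightarrow> c < p \<Longrightarrow> hcat r Ds $$ (i, k * p + c) = (Ds ! k) $$ (i, c)"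
proof -
  have len: "length (concat (map cols Ds)) = length Ds * p"
    using assms by (induction Ds) auto
  then show "hcat r Ds \<in> carrier_mat r (length Ds * p)"
    by (auto simp: hcat_def)
  assume kic: "k < length Ds" "i < r" "c < p"
  have "k * p + c < Suc k * p" using kic by simp
  also have "\<dots> \<le> length Ds * p" using kic by (intro mult_le_mono1) simp
  finally have "k * p + c < length (concat (map cols Ds))" using len by simp
  moreover have "concat (map cols Ds) ! (k * p + c) = map cols Ds ! k ! c"
    using kic carrier_matD(2)[OF assms] by (intro nth_concat_uniform) auto
  moreover have "Ds ! k \<in> carrier_mat r p" using kic assms by simp
  ultimately show "hcat r Ds $$ (i, k * p + c) = (Ds ! k) $$ (i, c)"
    using kic by (simp add: hcat_def mat_of_cols_index)
qed

section \<open>From automorphisms of H to the group T\<close>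

lemma hcat_one:
  assumes C: "C \<in> carrier_mat p n"
  shows "hcat p [1\<^sub>m p, C] \<in> carrier_mat p (p + n)"
    and "j < p \<Longrightarrow> col (hcat p [1\<^sub>m p, C]) j = unit_vec p j"
    and "j < n \<Longrightarrow> col (hcat p [1\<^sub>m p, C]) (p + j) = col C j"
  using C by (auto simp: hcat_def nth_append)

text \<open>Membership of all entries in \<open>F2\<close> singles out the columns of the identity
  block and is preserved by \<open>A\<close> and its inverse. On that block \<open>A\<close> is then
  a permutation matrix, and comparing the other columns gives the entry formula.\<close>

lemma Aut_standard_form:
  fixes C :: "'a :: field mat"
  assumes char: "(1 :: 'a) + 1 = 0" and C: "C \<in> carrier_mat p n"
    and notF2: "\<And>j. j < n \<Longrightarrow> \<exists>i<p. C $$ (i, j) \<notin> F2"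
    and s: "s \<in> Aut (hcat p [1\<^sub>m p, C])"
  shows "s permutes {..<p + n}"
    and "\<And>j. j < p + n \<Longrightarrow> s j < p \<longleftrightarrow> j < p"
    and "\<And>i j. i < p \<Longrightarrow> j < n \<Longrightarrow> C $$ (s i, s (p + j) - p) = C $$ (i, j)"
proof -
  define H where "H = hcat p [1\<^sub>m p, C]"
  note H = hcat_one[OF C, folded H_def]
  have dimH: "dim_row H = p" "dim_col H = p + n" using H(1) by auto
  show perm: "s permutes {..<p + n}"
    using s dimH by (simp add: Aut_def H_def)
  have lt: "s j < p + n" if "j < p + n" for j
    using permutes_in_image[OF perm, of j] that by simp
  have carr: "col H j \<in> carrier_vec p" for j
    using col_dim[of H j] dimH by simp
  obtain A B where A: "A \<in> carrier_mat p p" "elements_mat A \<subseteq> F2"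
    and B: "B \<in> carrier_mat p p" "elements_mat B \<subseteq> F2"
    and BA: "B * A = 1\<^sub>m p" and AHP: "A * H * perm_mat (p + n) s = H"
    using s dimH by (auto simp: Aut_def H_def GL_def inverts_mat_def)
  have Acol: "A *\<^sub>v col H (s j) = col H j" if j: "j < p + n" for j
  proof (rule eq_vecI)
    fix i assume "i < dim_vec (col H j)"
    then have i: "i < p" using dimH by simp
    have "(A * H * perm_mat (p + n) s) $$ (i, j) = (A * H) $$ (i, s j)"
      using A(1) H(1) i j by (intro index_mult_perm_mat[OF _ perm]) auto
    then show "(A *\<^sub>v col H (s j)) $ i = col H j $ i"
      using AHP A(1) dimH i j lt[OF j] by simp
  qed (use A(1) dimH in auto)
  \<comment> \<open>The inverse supplies the converse direction: it shows that \<open>s\<close>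
    keeps the indices below \<open>p\<close> below \<open>p\<close>.\<close>
  have Bcol: "B *\<^sub>v col H j = col H (s j)" if j: "j < p + n" for j
  proof -
    have "B *\<^sub>v (A *\<^sub>v col H (s j)) = (B * A) *\<^sub>v col H (s j)"
      by (rule assoc_mult_mat_vec[OF B(1) A(1) carr, symmetric])
    also have "\<dots> = col H (s j)"
      unfolding BA by (rule one_mult_mat_vec[OF carr])
    finally have "B *\<^sub>v (A *\<^sub>v col H (s j)) = col H (s j)" .
    then show ?thesis using Acol[OF j] by simp
  qed
  have colF2: "(\<forall>i<p. col H j $ i \<in> F2) \<longleftrightarrow> j < p" if j: "j < p + n" for j
  proof (cases "j < p")
    case True
    then show ?thesis using H(2) by (auto simp: F2_def)
  next
    case False
    then have "col H j = col C (j - p)" using H(3)[of "j - p"] j by simp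
    then show ?thesis using False j notF2[of "j - p"] C by auto
  qed
  show small: "s j < p \<longleftrightarrow> j < p" if j: "j < p + n" for j
  proof
    assume "s j < p"
    then have "(A *\<^sub>v col H (s j)) $ i \<in> F2" if "i < p" for i
      using mult_mat_vec_F2[OF char A carr _ that] colF2[OF lt[OF j]] by blast
    then show "j < p" using colF2[OF j] Acol[OF j] by simp
  next
    assume "j < p"
    then have "(B *\<^sub>v col H j) $ i \<in> F2" if "i < p" for i
      using mult_mat_vec_F2[OF char B carr _ that] colF2[OF j] by blast
    then show "s j < p" using colF2[OF lt[OF j]] Bcol[OF j] by simp
  qed
  \<comment> \<open>\<open>A\<close> takes the unit vector at \<open>s j\<close> to the one at
    \<open>j\<close>, so row \<open>i\<close> of \<open>A\<close> has its only 1 in column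
    \<open>s i\<close>.\<close>
  have Aij: "A $$ (i, s j) = (if i = j then 1 else 0)" if "i < p" "j < p" for i j
  proof -
    have "s j < p" using small[of j] that by simp
    then have "(A *\<^sub>v unit_vec p (s j)) $ i = unit_vec p j $ i"
      using Acol[of j] H(2) that by simp
    then show ?thesis
      using A(1) that \<open>s j < p\<close> by (simp add: scalar_prod_right_unit)
  qed
  fix i j assume ij: "i < p" "j < n"
  define k where "k = s (p + j) - p"
  have k: "s (p + j) = p + k" "k < n"
    using small[of "p + j"] lt[of "p + j"] ij by (auto simp: k_def)
  have "A $$ (i, l) = (if l = s i then 1 else 0)" if l: "l < p" for l
  proof -
    obtain l' where "l' < p + n" "s l' = l"
      using permutes_lessThan_preimage[OF perm, of l] l by auto
    moreover from this have "l' < p" using small[of l'] l by simp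
    ultimately show ?thesis
      using Aij[of i l'] ij permutes_inj[OF perm] by (auto simp: inj_eq)
  qed
  then have Ai: "A $$ (i, l) * C $$ (l, k) = (if l = s i then C $$ (l, k) else 0)" if "l < p" for l
    using that by simp
  have "(A *\<^sub>v col C k) $ i = (\<Sum>l = 0..<p. A $$ (i, l) * C $$ (l, k))"
    using A(1) C ij k by (simp add: scalar_prod_def)
  also have "\<dots> = (\<Sum>l = 0..<p. if l = s i then C $$ (l, k) else 0)"
    using Ai by (intro sum.cong) simp_all
  also have "\<dots> = C $$ (s i, k)" using small[of i] ij by simp
  finally show "C $$ (s i, s (p + j) - p) = C $$ (i, j)"
    using Acol[of "p + j"] H(3)[of j] H(3)[of k] k ij C by (simp add: k_def[symmetric])
qed

text \<open>Restriction to the identity block lands in \<open>T_group C\<close>, and it is injective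
  because the action on rows leaves only one possible target for each of the distinct columns of
  \<open>C\<close>.\<close>

lemma card_Aut_le_card_T_group:
  fixes C :: "'a :: field mat"
  assumes char: "(1 :: 'a) + 1 = 0" and C: "C \<in> carrier_mat p n" and dist: "distinct (cols C)"
    and notF2: "\<And>j. j < n \<Longrightarrow> \<exists>i<p. C $$ (i, j) \<notin> F2"
  shows "card (Aut (hcat p [1\<^sub>m p, C])) \<le> card (T_group C)"
proof (rule card_inj_on_le)
  define \<Phi> where "\<Phi> s = (\<lambda>i. if i < p then s i else i)" for s :: "nat \<Rightarrow> nat"
  have perm: "s permutes {..<p + n}" and small: "\<And>j. j < p + n \<Longrightarrow> s j < p \<longleftrightarrow> j < p"
    and entry: "\<And>i j. i < p \<Longrightarrow> j < n \<Longrightarrow> C $$ (s i, s (p + j) - p) = C $$ (i, j)"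
    if "s \<in> Aut (hcat p [1\<^sub>m p, C])" for s
    using Aut_standard_form[OF char C _ that] notF2 by blast+
  show "\<Phi> ` Aut (hcat p [1\<^sub>m p, C]) \<subseteq> T_group C"
  proof safe
    fix s assume s: "s \<in> Aut (hcat p [1\<^sub>m p, C])"
    have inj: "inj s" using permutes_inj[OF perm[OF s]] by blast
    have onto: "\<exists>k<p + n. s k = j" if "j < p + n" for j
      using permutes_lessThan_preimage[OF perm[OF s], of j] that by blast
    have "\<Phi> s ` {..<p} = {..<p}"
      using small[OF s] inj by (intro endo_inj_surj inj_onI) (auto simp: \<Phi>_def inj_eq)
    then have "bij_betw (\<Phi> s) {..<p} {..<p}"
      by (simp add: bij_betw_def eq_card_imp_inj_on)
    then have "\<Phi> s permutes {..<p}"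
      by (rule bij_imp_permutes) (simp add: \<Phi>_def)
    moreover have "\<exists>k<n. \<forall>i<p. C $$ (\<Phi> s i, j) = C $$ (i, k)" if j: "j < n" for j
    proof -
      obtain k where k: "k < p + n" "s k = p + j" using onto[of "p + j"] j by auto
      then have "\<not> k < p" using small[OF s, of k] by simp
      then show ?thesis
        using k entry[OF s, of _ "k - p"] by (intro exI[of _ "k - p"]) (auto simp: \<Phi>_def)
    qed
    ultimately show "\<Phi> s \<in> T_group C" by (simp add: T_group_iff[OF C dist])
  qed
  show "inj_on \<Phi> (Aut (hcat p [1\<^sub>m p, C]))"
  proof (rule inj_onI)
    fix s t assume s: "s \<in> Aut (hcat p [1\<^sub>m p, C])" and t: "t \<in> Aut (hcat p [1\<^sub>m p, C])"
      and eq: "\<Phi> s = \<Phi> t"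
    have st: "s i = t i" if "i < p" for i
      using fun_cong[OF eq, of i] that by (simp add: \<Phi>_def)
    note perm_s = perm[OF s] and perm_t = perm[OF t]
    have "s (p + j) = t (p + j)" if j: "j < n" for j
    proof -
      have ge: "p \<le> s (p + j)" "p \<le> t (p + j)"
        using small[OF s, of "p + j"] small[OF t, of "p + j"] j by simp_all
      have lt: "s (p + j) < p + n" "t (p + j) < p + n"
        using permutes_in_image[OF perm_s, of "p + j"] permutes_in_image[OF perm_t, of "p + j"] j
        by simp_all
      \<comment> \<open>With \<open>i = s i' = t i'\<close>, both sides equal
        \<open>C $$ (i', j)\<close> by the entry formula.\<close>
      have "C $$ (i, s (p + j) - p) = C $$ (i, t (p + j) - p)" if i: "i < p" for i
      proof -
        obtain i' where i': "i' < p + n" "s i' = i"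
          using permutes_lessThan_preimage[OF perm_s, of i] i by auto
        then have "i' < p" using i small[OF s, of i'] by simp
        then show ?thesis
          using entry[OF s, of i' j] entry[OF t, of i' j] i' j st[of i'] by simp
      qed
      then have "col C (s (p + j) - p) = col C (t (p + j) - p)"
        using C ge lt by (intro eq_vecI) auto
      then have "s (p + j) - p = t (p + j) - p"
        using distinct_cols_eq[OF dist] C ge lt by simp
      then show ?thesis using ge by simp
    qed
    then have "s i = t i" if "i < p + n" for i
      using that st[of i] by (metis le_add_diff_inverse nat_add_left_cancel_less not_less)
    then show "s = t"
      using perm_s perm_t by (metis ext permutes_not_in lessThan_iff)
  qed
  show "finite (T_group C)"
    by (rule finite_subset[OF _ finite_permutations[of "{..<p}"]]) (use C in \<open>auto simp: T_group_def\<close>)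
qed

text \<open>A cyclic shift of the rows is undone by a cyclic shift of the columns inside each
  block.\<close>

lemma cycle_in_T_group:
  fixes Cs :: "'a :: field mat list"
  assumes p: "0 < p" and circ: "\<And>D. D \<in> set Cs \<Longrightarrow> circulant p D"
    and dist: "distinct (cols (hcat p Cs))"
  shows "(\<lambda>i. if i < p then Suc i mod p else i) \<in> T_group (hcat p Cs)"
proof -
  define s where "s = (\<lambda>i. if i < p then Suc i mod p else i)"
  have carr: "D \<in> carrier_mat p p" if "D \<in> set Cs" for D
    using circ[OF that] by (simp add: circulant_def)
  note C = hcat_blocks[of Cs p p, OF carr]
  have "inj_on s {..<p}"
    by (rule inj_onI) (auto simp: s_def mod_Suc split: if_splits)
  then have "bij_betw s {..<p} {..<p}"
    unfolding bij_betw_def using p by (intro conjI endo_inj_surj) (auto simp: s_def)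
  then have perm: "s permutes {..<p}"
    by (rule bij_imp_permutes) (simp add: s_def)
  have "\<exists>k<length Cs * p. \<forall>i<p. hcat p Cs $$ (s i, j) = hcat p Cs $$ (i, k)"
    if j: "j < length Cs * p" for j
  proof -
    \<comment> \<open>\<open>b\<close> is the block of column \<open>j\<close>, \<open>c\<close> its
      position there, and \<open>d\<close> the cyclic predecessor of \<open>c\<close>.\<close>
    define b c d where "b = j div p" and "c = j mod p" and "d = (c + (p - 1)) mod p"
    have b: "b < length Cs" using j p by (simp add: b_def less_mult_imp_div_less)
    have jbc: "j = b * p + c" by (simp add: b_def c_def)
    have cd: "c < p" "d < p" using p by (simp_all add: c_def d_def)
    have "Suc d mod p = (c + p) mod p"
      using p unfolding d_def by (simp add: mod_Suc_eq)
    then have dc: "Suc d mod p = c" using cd by simp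
    have "b * p + d < Suc b * p" using cd by simp
    also have "\<dots> \<le> length Cs * p" using b by (intro mult_le_mono1) simp
    finally have "b * p + d < length Cs * p" .
    moreover have "hcat p Cs $$ (s i, j) = hcat p Cs $$ (i, b * p + d)" if i: "i < p" for i
    proof -
      have "hcat p Cs $$ (s i, j) = Cs ! b $$ (Suc i mod p, Suc d mod p)"
        using C(2)[OF _ b _ cd(1), of "Suc i mod p"] i p by (simp add: s_def jbc dc)
      also have "\<dots> = Cs ! b $$ (i, d)"
        using circ b i cd(2) by (intro circulant_cycle) auto
      also have "\<dots> = hcat p Cs $$ (i, b * p + d)"
        using C(2)[OF _ b i cd(2)] by simp
      finally show ?thesis .
    qed
    ultimately show ?thesis by blast
  qed
  then show ?thesis
    using perm T_group_iff[OF C(1) dist, of s] by (simp add: s_def)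
qed

theorem theorem4p3p7:
  fixes p m l :: nat
    and Cs :: "'a :: {field, finite} mat list"
    and C H :: "'a mat"
  assumes "prime p" and "m > 0"
    and "CARD('a) = 2 ^ l"
    and "length Cs = m - 1"
    and "\<And>D. D \<in> set Cs \<Longrightarrow> circulant p D"
    and "\<And>D. D \<in> set Cs \<Longrightarrow> \<exists>x \<in> elements_mat D. x \<notin> F2"
    and "C = hcat p Cs"
    and "H = hcat p [1\<^sub>m p, C]"
    and "distinct (cols C)"
    and "\<not> two_transitive_on (T_group C) {..<p}"
  shows "card (Aut H) \<le> p * (p - 1)"
proof -
  have p0: "0 < p" using prime_gt_0_nat[OF assms(1)] .
  have carr: "D \<in> carrier_mat p p" if "D \<in> set Cs" for D
    using assms(5)[OF that] by (simp add: circulant_def)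
  define n where "n = length Cs * p"
  have C: "C \<in> carrier_mat p n"
    unfolding n_def assms(7) by (rule hcat_blocks(1)[OF carr])
  \<comment> \<open>One entry outside \<open>F2\<close> per block is enough, since the circulant
    structure spreads it over all columns of the block.\<close>
  have notF2: "\<exists>i<p. C $$ (i, j) \<notin> F2" if j: "j < n" for j
  proof -
    have b: "j div p < length Cs" using j by (simp add: n_def less_mult_imp_div_less)
    then have D: "Cs ! (j div p) \<in> set Cs" by simp
    obtain x where x: "x \<in> elements_mat (Cs ! (j div p))" "x \<notin> F2"
      using assms(6)[OF D] by blast
    obtain i where i: "i < p" "Cs ! (j div p) $$ (i, j mod p) \<notin> F2"
      using circulant_col_not_F2[OF assms(5)[OF D] x, of "j mod p"] p0 by auto
    have "C $$ (i, j div p * p + j mod p) = Cs ! (j div p) $$ (i, j mod p)"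
      unfolding assms(7) using b i(1) p0 by (intro hcat_blocks(2) carr) simp_all
    then show ?thesis using i by auto
  qed
  have "card (Aut H) \<le> card (T_group C)"
    unfolding assms(8)
    by (rule card_Aut_le_card_T_group[OF finite_field_char_2[OF assms(3)] C assms(9) notF2])
  also have "\<dots> \<le> p * (p - 1)"
  proof (rule card_le_if_not_two_transitive[OF assms(1) _ _ _ _ assms(10)])
    show "g permutes {..<p}" if "g \<in> T_group C" for g
      using that T_group_iff[OF C assms(9)] by blast
    show "g \<circ> h \<in> T_group C" if "g \<in> T_group C" "h \<in> T_group C" for g h
      using comp_in_T_group[OF C assms(9) that] .
    show "(\<lambda>i. if i < p then Suc i mod p else i) \<in> T_group C"
      using cycle_in_T_group[OF p0 assms(5)] assms(7,9) by simp
  qed simp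
  finally show ?thesis .
qed

end
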